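(* Let $S_n(1324)$ denote the number of permutations of length $n$ avoiding the pattern $1324$, and let $L(1324)=\lim_{n\to\infty}\sqrt[n]{S_n(1324)}$ (this limit exists). Then $L(1324)\leq 13.7595074$.
   Context: A permutation $p=p_1\cdots p_n$ avoids $1324$ if there are no indices $i_1<i_2<i_3<i_4$ with $p_{i_1}<p_{i_3}<p_{i_2}<p_{i_4}$. *)

theory Defs
  imports Complex_Main
begin

definition perms_of_length :: "nat \<Rightarrow> nat list set" where
  "perms_of_length n = {p. distinct p \<and> set p = {1..n}}"

definition avoids_1324 :: "nat list \<Rightarrow> bool" where
  "avoids_1324 p \<longleftrightarrow> \<not> (\<exists>i1 i2 i3 i4. i1 < i2 \<and> i2 < i3 \<and> i3 < i4 \<and> i4 < length p \<and>
      p ! i1 < p ! i3 \<and> p ! i3 < p ! i2 \<and> p ! i2 < p ! i4)"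

definition S_1324 :: "nat \<Rightarrow> nat" where
  "S_1324 n = card {p \<in> perms_of_length n. avoids_1324 p}"

end

theory Submission
  imports Defs "HOL-Computational_Algebra.Polynomial"
begin

text \<open>
  Colour the entries of a 1324-avoider from left to right: an entry is blue if it would complete a
  red 132 or if a smaller blue entry precedes it, and red otherwise. The reds avoid 132, the blues
  avoid 213, and every red entry is smaller than all blue entries to its left. Hence, if reds \<open>r\<close>,
  \<open>r'\<close> and blues \<open>b\<close>, \<open>b'\<close> occurred in the order \<open>r b r' b'\<close> with \<open>r < r'\<close> and \<open>b < b'\<close>, they would
  form a 1324. So the two colour classes with their interleaved positions, values compared only
  within a class, form a ``domino'' (Bevan, Brignall, Elvey Price and Pennington), and
  the permutation is recovered from the domino and the set of blue values, which costs a factor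
  \<open>2^n\<close>.

  A domino is a pair of noncrossing arc systems: each red entry is joined to the first smaller
  red entry, each blue one to the last larger blue entry. Reading positions from left to right
  yields a walk on stacks of red entries separated by pending blue ones. Let \<open>G(u)\<close> be the generating
  function of the walks without pending blue entries, with \<open>t\<close> marking length and \<open>u\<close> the number of
  red entries on the stack. Then
  \<open>G(u) = 1 + t (u G(u) + u (G(u) - G(1)) / (u - 1) + G(u) / (1 - t G(u)))\<close>. The true radius of convergence is
  \<open>4/27\<close>; at \<open>t = 8/55\<close> boundedness follows by fixing \<open>u = 8/5\<close> and bounding \<open>G(1)\<close> from below by a few
  iterations. This gives the growth rate \<open>2 / t = 13.75\<close>. The limit exists because skew sums
  make the counting sequence supermultiplicative.
\<close>

section \<open>The functional equation\<close>

definition coeff_le :: "real poly \<Rightarrow> real poly \<Rightarrow> bool" where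
  "coeff_le p q \<longleftrightarrow> (\<forall>i. coeff p i \<le> coeff q i)"

lemma coeff_le_refl [simp]: "coeff_le p p"
  by (simp add: coeff_le_def)

lemma coeff_le_trans: "coeff_le p q \<Longrightarrow> coeff_le q r \<Longrightarrow> coeff_le p r"
  unfolding coeff_le_def using order_trans by blast

lemma coeff_le_pCons [simp]: "coeff_le (pCons a p) (pCons b q) \<longleftrightarrow> a \<le> b \<and> coeff_le p q"
  unfolding coeff_le_def
  by (metis coeff_pCons_0 coeff_pCons_Suc not0_implies_Suc)

lemma coeff_le_0_pCons [simp]: "coeff_le 0 (pCons b q) \<longleftrightarrow> 0 \<le> b \<and> coeff_le 0 q"
  using coeff_le_pCons[of 0 0 b q] by simp

lemma coeff_le_add: "coeff_le p q \<Longrightarrow> coeff_le r s \<Longrightarrow> coeff_le (p + r) (q + s)"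
  by (simp add: coeff_le_def add_mono)

lemma coeff_le_smult: "0 \<le> c \<Longrightarrow> coeff_le p q \<Longrightarrow> coeff_le (smult c p) (smult c q)"
  by (simp add: coeff_le_def mult_left_mono)

lemma coeff_le_mult:
  assumes "coeff_le 0 p" "coeff_le p q" "coeff_le 0 r" "coeff_le r s"
  shows "coeff_le (p * r) (q * s)"
proof -
  have "coeff p i * coeff r j \<le> coeff q i * coeff s j" for i j
    using assms by (intro mult_mono) (auto simp: coeff_le_def intro: order_trans)
  then show ?thesis
    by (auto simp: coeff_le_def coeff_mult intro: sum_mono)
qed

lemma coeff_le_power:
  assumes "coeff_le 0 p" "coeff_le p q"
  shows "coeff_le 0 (p ^ k) \<and> coeff_le (p ^ k) (q ^ k)"
proof (induction k)
  case (Suc k)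
  have "coeff_le (0 * 0) (p * p ^ k)"
    using Suc assms by (intro coeff_le_mult) auto
  with Suc assms show ?case
    by (auto intro: coeff_le_mult)
qed (simp add: coeff_le_def)

lemma coeff_le_sum:
  "(\<And>k. k \<in> A \<Longrightarrow> coeff_le (f k) (g k)) \<Longrightarrow> coeff_le (sum f A) (sum g A)"
  by (simp add: coeff_le_def coeff_sum sum_mono)

lemma poly_mono_coeff_le:
  assumes "coeff_le p q" "0 \<le> u"
  shows "poly p u \<le> poly q u"
  using assms(1)
proof (induction p arbitrary: q)
  case 0
  then show ?case
    using assms(2) by (induction q) auto
next
  case (pCons a p)
  obtain b q' where "q = pCons b q'" by (cases q)
  with pCons assms(2) show ?case by (auto intro!: add_mono mult_left_mono)
qed

lemma poly_mono_point:
  fixes u v :: real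
  assumes "coeff_le 0 p" "0 \<le> u" "u \<le> v"
  shows "poly p u \<le> poly p v"
  using assms(1)
proof (induction p)
  case (pCons a p)
  then have "u * poly p u \<le> v * poly p v"
    using assms(2,3) poly_mono_coeff_le[of 0 p u] by (intro mult_mono) auto
  then show ?case by simp
qed simp

text \<open>Each coefficient of the divided difference at 1 is a tail sum of coefficients, hence
  monotone. Pointwise comparison would fail here, because (p(u) - p(1)) / (u - 1) decreases in
  p(1).\<close>

lemma coeff_le_synthetic_div:
  assumes "coeff_le p q"
  shows "coeff_le (synthetic_div p 1) (synthetic_div q 1)"
  using assms
proof (induction p arbitrary: q)
  case 0
  then show ?case
    using poly_mono_coeff_le[of 0 _ 1] by (induction q) auto
next
  case (pCons a p)
  obtain b q' where "q = pCons b q'" by (cases q)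
  with pCons show ?case by (auto intro!: poly_mono_coeff_le)
qed

lemma sum_coeff_le_poly_1:
  assumes "coeff_le 0 p" "finite A"
  shows "sum (coeff p) A \<le> poly p 1"
proof -
  have "sum (coeff p) A \<le> sum (coeff p) (A \<union> {..degree p})"
    using assms by (intro sum_mono2) (auto simp: coeff_le_def)
  also have "\<dots> = poly p 1"
    using assms(2) by (simp add: poly_altdef) (rule sum.mono_neutral_right, auto simp: coeff_eq_0)
  finally show ?thesis .
qed

text \<open>A red pop can leave a top run of length \<open>Suc m\<close> from any length
  \<open>j\<close> at least that; summing over such \<open>j\<close> gives part of the tail sum held
  by coefficient \<open>m\<close> of the divided difference.\<close>

lemma sum_coeff_le_synthetic_div:
  assumes "coeff_le 0 p"
  shows "(\<Sum>j = Suc m..n. coeff p j) \<le> coeff (synthetic_div p 1) m"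
  using assms
proof (induction m arbitrary: p n)
  case (0 p)
  obtain a q where p: "p = pCons a q" by (cases p)
  have "sum (coeff q) {..<n} \<le> poly q 1"
    using 0 p by (intro sum_coeff_le_poly_1) auto
  also have "sum (coeff q) {..<n} = (\<Sum>j = Suc 0..n. coeff p j)"
    unfolding p by (rule sum.reindex_bij_witness[of _ "\<lambda>j. j - 1" Suc]) (auto simp: coeff_pCons split: nat.split)
  finally show ?case by (simp add: p)
next
  case (Suc m p)
  obtain a q where p: "p = pCons a q" by (cases p)
  have "(\<Sum>j = Suc (Suc m)..n. coeff p j) = (\<Sum>j = Suc m..n - 1. coeff q j)"
    unfolding p by (rule sum.reindex_bij_witness[of _ Suc "\<lambda>j. j - 1"]) (auto simp: coeff_pCons split: nat.split)
  with Suc p show ?case by simp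
qed

text \<open>Gives the total weight of the ways in which a blue pop merges \<open>k\<close> runs into
  one of length \<open>m\<close>. Finiteness is part of the same induction because splitting the sum
  over a disjoint union requires it.\<close>

lemma coeff_power_eq_sum_lists:
  fixes p :: "real poly"
  shows "finite {ps. length ps = k \<and> sum_list ps = m} \<and>
    coeff (p ^ k) m = (\<Sum>ps | length ps = k \<and> sum_list ps = (m::nat). prod_list (map (coeff p) ps))"
proof (induction k arbitrary: m)
  case 0
  have "{ps. length ps = 0 \<and> sum_list ps = m} = (if m = 0 then {[]} else {})"
    by auto
  then show ?case by simp
next
  case (Suc k)
  let ?A = "\<lambda>k m. {ps::nat list. length ps = k \<and> sum_list ps = m}"
  have eq: "?A (Suc k) m = (\<Union>a\<le>m. Cons a ` ?A k (m - a))"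
  proof (intro equalityI subsetI)
    fix ps assume "ps \<in> ?A (Suc k) m"
    then show "ps \<in> (\<Union>a\<le>m. Cons a ` ?A k (m - a))"
      by (cases ps) (auto intro!: bexI[of _ "hd ps"])
  qed auto
  have "(\<Sum>ps\<in>?A (Suc k) m. prod_list (map (coeff p) ps)) =
      (\<Sum>a\<le>m. \<Sum>ps\<in>Cons a ` ?A k (m - a). prod_list (map (coeff p) ps))"
    unfolding eq using Suc by (intro sum.UNION_disjoint) auto
  also have "\<dots> = (\<Sum>a\<le>m. coeff p a * coeff (p ^ k) (m - a))"
    using Suc by (intro sum.cong) (simp_all add: sum.reindex sum_distrib_left)
  finally show ?case
    using Suc unfolding eq by (simp add: coeff_mult)
qed

text \<open>
  The right-hand side of the functional equation at \<open>t = 8/55\<close>, with the geometric series truncated;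
  \<open>synthetic_div p 1\<close> is \<open>(p(u) - p(1)) / (u - 1)\<close>.
\<close>

definition step_poly :: "nat \<Rightarrow> real poly \<Rightarrow> real poly" where
  "step_poly K p = 1 + smult (8/55)
     (pCons 0 (p + synthetic_div p 1) + p * (\<Sum>k\<le>K. smult (8/55) p ^ k))"

abbreviation run_poly :: "nat \<Rightarrow> nat \<Rightarrow> real poly" where
  "run_poly K n \<equiv> (step_poly K ^^ n) 1"

text \<open>Monotonicity in the truncation order lets lower bounds computed once with
  \<open>K = 3\<close> serve for all larger \<open>K\<close>.\<close>

lemma step_poly_mono:
  assumes "coeff_le 0 p" "coeff_le p q" "K \<le> K'"
  shows "coeff_le (step_poly K p) (step_poly K' q)"
proof -
  let ?s = "smult (8/55) :: real poly \<Rightarrow> real poly"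
  have s: "coeff_le 0 (?s p)" "coeff_le (?s p) (?s q)"
    using coeff_le_smult[of "8/55" 0 p] coeff_le_smult[of "8/55" p q] assms by auto
  have pw: "coeff_le 0 (?s p ^ k)" "coeff_le (?s p ^ k) (?s q ^ k)" for k
    using coeff_le_power[OF s] by auto
  have "coeff_le 0 (\<Sum>k\<le>K. ?s p ^ k)"
    using coeff_le_sum[of "{..K}" "\<lambda>_. 0", OF pw(1)] by simp
  moreover have "coeff_le (\<Sum>k\<le>K. ?s p ^ k) (\<Sum>k\<le>K'. ?s q ^ k)"
  proof -
    have "coeff_le 0 (?s q ^ k)" for k
      using pw coeff_le_trans by blast
    then have "coeff_le (\<Sum>k\<le>K. ?s q ^ k) (\<Sum>k\<le>K'. ?s q ^ k)"
      using assms(3) by (auto simp: coeff_le_def coeff_sum intro!: sum_mono2)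
    moreover have "coeff_le (\<Sum>k\<le>K. ?s p ^ k) (\<Sum>k\<le>K. ?s q ^ k)"
      by (intro coeff_le_sum pw)
    ultimately show ?thesis using coeff_le_trans by blast
  qed
  ultimately show ?thesis
    unfolding step_poly_def using assms
    by (intro coeff_le_add coeff_le_smult coeff_le_mult) (simp_all add: coeff_le_add coeff_le_synthetic_div)
qed

lemma step_poly_ge_1:
  assumes "coeff_le 0 p"
  shows "coeff_le 1 (step_poly K p)"
proof -
  have "coeff_le (step_poly K 0) (step_poly K p)"
    by (rule step_poly_mono) (use assms in auto)
  then show ?thesis by (simp add: step_poly_def)
qed

lemma coeff_le_0_1: "coeff_le 0 1"
  by (simp add: coeff_le_def)

lemma run_poly_nonneg: "coeff_le 0 (run_poly K n)"
  by (induction n) (auto intro: coeff_le_0_1 coeff_le_trans step_poly_ge_1)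

lemma run_poly_Suc: "coeff_le (run_poly K n) (run_poly K (Suc n))"
  by (induction n) (auto intro!: step_poly_ge_1 step_poly_mono coeff_le_0_1 run_poly_nonneg[simplified])

lemma run_poly_mono: "m \<le> n \<Longrightarrow> coeff_le (run_poly K m) (run_poly K n)"
proof (induction n rule: dec_induct)
  case (step n)
  then show ?case using run_poly_Suc coeff_le_trans by blast
qed simp

section \<open>Upper bound at u = 8/5, uniform in the truncation\<close>

lemma poly_step_poly_le:
  assumes "coeff_le 0 p" "poly p (8/5) \<le> x" "x < 55/8" "y \<le> poly p 1"
    and z: "1 + 8/55 * (8/5 * x + 8/3 * (x - y) + x / (1 - 8/55 * x)) \<le> z"
  shows "poly (step_poly K p) (8/5) \<le> z"
proof -
  define f where "f = poly p (8/5)"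
  have f0: "0 \<le> f"
    using poly_mono_coeff_le[OF assms(1), of "8/5"] by (simp add: f_def)
  \<comment> \<open>Dividing by \<open>u - 1 = 3/5\<close> turns the divided difference into
    \<open>5/3 * (f - poly p 1)\<close>; with the outer factor \<open>u = 8/5\<close> this gives the
    \<open>8/3\<close> in the hypothesis.\<close>
  have "poly p (8/5) = 3/5 * poly (synthetic_div p 1) (8/5) + poly p 1"
    using arg_cong[OF synthetic_div_correct'[of 1 p], of "\<lambda>q. poly q (8/5)"] by simp
  then have sd: "poly (synthetic_div p 1) (8/5) = 5/3 * (f - poly p 1)"
    by (simp add: f_def)
  have fx: "f \<le> x" using assms(2) by (simp add: f_def)
  \<comment> \<open>The truncated geometric series lies below its full sum, which is finite and
    increasing since \<open>x < 55/8\<close> keeps the ratio below 1.\<close>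
  have "f * (\<Sum>k\<le>K. (8/55 * f) ^ k) \<le> x * (1 / (1 - 8/55 * x))"
  proof (intro mult_mono)
    have "(\<Sum>k\<le>K. (8/55 * f) ^ k) = (1 - (8/55 * f) ^ Suc K) / (1 - 8/55 * f)"
      using fx assms(3) by (simp add: sum_gp0)
    also have "\<dots> \<le> 1 / (1 - 8/55 * f)"
      using f0 fx assms(3) by (intro divide_right_mono) auto
    also have "\<dots> \<le> 1 / (1 - 8/55 * x)"
      using fx assms(3) by (intro divide_left_mono) auto
    finally show "(\<Sum>k\<le>K. (8/55 * f) ^ k) \<le> 1 / (1 - 8/55 * x)" .
  qed (use f0 fx in \<open>auto intro!: sum_nonneg\<close>)
  then have "poly (step_poly K p) (8/5) \<le>
      1 + 8/55 * (8/5 * (f + 5/3 * (f - poly p 1)) + x / (1 - 8/55 * x))"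
    by (simp add: step_poly_def poly_sum poly_power sd flip: f_def)
  also have "\<dots> \<le> 1 + 8/55 * (8/5 * x + 8/3 * (x - y) + x / (1 - 8/55 * x))"
    using fx assms(4) by (simp add: field_simps)
  also note z
  finally show ?thesis .
qed

text \<open>One round of a double iteration: the coefficient lower bound bounds
  \<open>poly (run_poly K n) 1\<close> from below, and that value enters the upper bound at
  \<open>8/5\<close> with a negative sign.\<close>

lemma run_poly_bounds_Suc:
  assumes "coeff_le p (run_poly K n) \<and> poly (run_poly K n) (8/5) \<le> x"
    and "3 \<le> K" "coeff_le 0 p" "x < 55/8"
    and "coeff_le q (step_poly 3 p)"
    and "1 + 8/55 * (8/5 * x + 8/3 * (x - poly p 1) + x / (1 - 8/55 * x)) \<le> z"
    and m: "m = Suc n"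
  shows "coeff_le q (run_poly K m) \<and> poly (run_poly K m) (8/5) \<le> z"
  unfolding m
proof
  have "coeff_le (step_poly 3 p) (run_poly K (Suc n))"
    using assms step_poly_mono[of p "run_poly K n" 3 K] by simp
  then show "coeff_le q (run_poly K (Suc n))"
    using assms(5) coeff_le_trans by blast
  show "poly (run_poly K (Suc n)) (8/5) \<le> z"
    using poly_step_poly_le[of "run_poly K n" x "poly p 1" z K, OF run_poly_nonneg] assms
      poly_mono_coeff_le[of p "run_poly K n" 1] by simp
qed

lemma step_poly_3:
  "step_poly 3 p = 1 + smult (8/55) (pCons 0 (p + synthetic_div p 1) +
     (let q = smult (8/55) p in p * (1 + q * (1 + q * (1 + q)))))"
  by (simp add: step_poly_def Let_def atMost_nat_numeral algebra_simps numeral_eq_Suc)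

text \<open>
  The lower bounds are the iterates of \<open>step_poly 3\<close> cut off at degree 3, the upper bounds those of
  the inequality in \<open>poly_step_poly_le\<close>; both are rounded to three decimals.
\<close>

lemma run_poly_bounds_11:
  assumes "3 \<le> K"
  shows "coeff_le [:1214/1000, 296/1000, 75/1000, 19/1000:] (run_poly K 11) \<and>
    poly (run_poly K 11) (8/5) \<le> 2117/1000"
proof -
  note step = run_poly_bounds_Suc[OF _ assms]
  have 0: "coeff_le [:1:] (run_poly K 0) \<and> poly (run_poly K 0) (8/5) \<le> 1"
    by (simp add: one_pCons)
  have 1: "coeff_le [:1170/1000, 145/1000:] (run_poly K 1) \<and>
      poly (run_poly K 1) (8/5) \<le> 1403/1000"
    by (rule step[OF 0]) (simp_all add: step_poly_3 one_pCons)
  have 2: "coeff_le [:1204/1000, 221/1000, 21/1000:] (run_poly K 2) \<and>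
      poly (run_poly K 2) (8/5) \<le> 1618/1000"
    by (rule step[OF 1]) (simp_all add: step_poly_3 one_pCons)
  have 3: "coeff_le [:1212/1000, 257/1000, 41/1000, 3/1000:] (run_poly K 3) \<and>
      poly (run_poly K 3) (8/5) \<le> 1752/1000"
    by (rule step[OF 2]) (simp_all add: step_poly_3 one_pCons)
  have 4: "coeff_le [:1213/1000, 274/1000, 54/1000, 7/1000:] (run_poly K 4) \<and>
      poly (run_poly K 4) (8/5) \<le> 1843/1000"
    by (rule step[OF 3]) (simp_all add: step_poly_3 one_pCons)
  have 5: "coeff_le [:1214/1000, 283/1000, 62/1000, 11/1000:] (run_poly K 5) \<and>
      poly (run_poly K 5) (8/5) \<le> 1910/1000"
    by (rule step[OF 4]) (simp_all add: step_poly_3 one_pCons)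
  have 6: "coeff_le [:1214/1000, 288/1000, 67/1000, 14/1000:] (run_poly K 6) \<and>
      poly (run_poly K 6) (8/5) \<le> 1962/1000"
    by (rule step[OF 5]) (simp_all add: step_poly_3 one_pCons)
  have 7: "coeff_le [:1214/1000, 291/1000, 70/1000, 16/1000:] (run_poly K 7) \<and>
      poly (run_poly K 7) (8/5) \<le> 2003/1000"
    by (rule step[OF 6]) (simp_all add: step_poly_3 one_pCons)
  have 8: "coeff_le [:1214/1000, 293/1000, 72/1000, 17/1000:] (run_poly K 8) \<and>
      poly (run_poly K 8) (8/5) \<le> 2038/1000"
    by (rule step[OF 7]) (simp_all add: step_poly_3 one_pCons)
  have 9: "coeff_le [:1214/1000, 294/1000, 74/1000, 18/1000:] (run_poly K 9) \<and>
      poly (run_poly K 9) (8/5) \<le> 2068/1000"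
    by (rule step[OF 8]) (simp_all add: step_poly_3 one_pCons)
  have 10: "coeff_le [:1214/1000, 295/1000, 75/1000, 18/1000:] (run_poly K 10) \<and>
      poly (run_poly K 10) (8/5) \<le> 2094/1000"
    by (rule step[OF 9]) (simp_all add: step_poly_3 one_pCons)
  have 11: "coeff_le [:1214/1000, 296/1000, 75/1000, 19/1000:] (run_poly K 11) \<and>
      poly (run_poly K 11) (8/5) \<le> 2117/1000"
    by (rule step[OF 10]) (simp_all add: step_poly_3 one_pCons)
  from 11 show ?thesis .
qed

lemma poly_run_poly_le:
  assumes "3 \<le> K"
  shows "poly (run_poly K n) 1 \<le> 13/5"
proof -
  let ?L = "[:1214/1000, 296/1000, 75/1000, 19/1000:] :: real poly"
  note 11 = run_poly_bounds_11[OF assms]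
  \<comment> \<open>With \<open>G(1) \<ge> ?L(1)\<close>, the map bounding the next value of \<open>G(8/5)\<close> sends \<open>13/5\<close> below itself.\<close>
  have *: "poly (run_poly K m) (8/5) \<le> 13/5" if "11 \<le> m" for m
    using that
  proof (induction m rule: dec_induct)
    case base
    from 11 show ?case by linarith
  next
    case (step m)
    have "coeff_le ?L (run_poly K m)"
      using 11 run_poly_mono[OF step(1)] coeff_le_trans by blast
    then have "poly ?L 1 \<le> poly (run_poly K m) 1"
      by (rule poly_mono_coeff_le) simp
    with step(3) show ?case
      using poly_step_poly_le[of "run_poly K m" "13/5" "poly ?L 1" "13/5" K, OF run_poly_nonneg] by simp
  qed
  have "poly (run_poly K n) 1 \<le> poly (run_poly K n) (8/5)"
    by (rule poly_mono_point[OF run_poly_nonneg]) auto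
  also have "\<dots> \<le> poly (run_poly K (max 11 n)) (8/5)"
    by (intro poly_mono_coeff_le run_poly_mono) auto
  also have "\<dots> \<le> 13/5"
    by (rule *) simp
  finally show ?thesis .
qed

section \<open>Counting walks\<close>

text \<open>
  A state lists, from the top of the stack, the lengths of the runs of red entries between consecutive
  pending blue entries; the flag of a step tells whether the entry read is blue.
\<close>

inductive run_step :: "bool \<Rightarrow> nat list \<Rightarrow> nat list \<Rightarrow> bool" where
  red_push: "run_step False (m # s) (Suc m # s)"
| red_pop: "1 \<le> m \<Longrightarrow> m \<le> j \<Longrightarrow> run_step False (j # s) (m # s)"
| blue_push: "s \<noteq> [] \<Longrightarrow> run_step True s (0 # s)"
| blue_pop: "ps \<noteq> [] \<Longrightarrow> run_step True (ps @ s) (sum_list ps # s)"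

inductive walk :: "(bool \<times> nat list) list \<Rightarrow> nat list \<Rightarrow> bool" where
  walk_Nil: "walk [] [0]"
| walk_Cons: "walk h s \<Longrightarrow> run_step b s s' \<Longrightarrow> walk ((b, s') # h) s'"

definition walks :: "nat \<Rightarrow> nat list \<Rightarrow> (bool \<times> nat list) list set" where
  "walks n s = {h. length h = n \<and> walk h s}"

text \<open>A red push lengthens a run by one, a blue push adds one run, and no other step increases
  the total; the \<open>Suc\<close> accounts for the initial run \<open>0\<close>. The bound limits
  which predecessors of a state have to be summed over.\<close>

lemma walk_bound: "walk h s \<Longrightarrow> s \<noteq> [] \<and> length s + sum_list s \<le> Suc (length h)"
proof (induction rule: walk.induct)
  case (walk_Cons h s b s')
  from walk_Cons(2) show ?case
  proof cases
    case (blue_pop ps r)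
    then have "1 \<le> length ps" by (cases ps) auto
    with blue_pop walk_Cons.IH show ?thesis by simp
  qed (use walk_Cons.IH in auto)
qed simp

lemma walks_0: "walks 0 s = (if s = [0] then {[]} else {})"
  by (auto simp: walks_def elim: walk.cases intro: walk_Nil)

lemma walks_Suc_subset:
  "walks (Suc n) (m # s) \<subseteq>
     (if m = 0 then if s = [] then {} else Cons (True, m # s) ` walks n s
      else Cons (False, m # s) ` walks n ((m - 1) # s) \<union>
        (\<Union>j\<in>{m..n}. Cons (False, m # s) ` walks n (j # s))) \<union>
     (\<Union>k\<le>n. \<Union>ps\<in>{ps. length ps = Suc k \<and> sum_list ps = m}. Cons (True, m # s) ` walks n (ps @ s))"
  (is "_ \<subseteq> ?A \<union> ?B")
proof
  fix w assume "w \<in> walks (Suc n) (m # s)"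
  then have w: "length w = Suc n" "walk w (m # s)" by (auto simp: walks_def)
  from w(2) show "w \<in> ?A \<union> ?B"
  proof cases
    case (walk_Cons h r b)
    have h: "h \<in> walks n r" using walk_Cons w by (auto simp: walks_def)
    from walk_Cons(3) show ?thesis
    proof cases
      case (red_push m')
      with h walk_Cons show ?thesis by auto
    next
      case (red_pop j)
      with walk_bound[OF walk_Cons(2)] h walk_Cons w have "j \<in> {m..n}" by auto
      with red_pop h walk_Cons show ?thesis by auto
    next
      case blue_push
      with h walk_Cons show ?thesis by auto
    next
      case (blue_pop ps)
      have "length ps \<le> Suc n" "length ps = Suc (length ps - 1)"
        using walk_bound[OF walk_Cons(2)] w walk_Cons blue_pop by auto
      then obtain k where "k \<le> n" "length ps = Suc k" by (metis Suc_le_mono)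
      with blue_pop h walk_Cons have "w \<in> ?B" by auto
      then show ?thesis by blast
    qed
  qed (use w in simp)
qed

lemma finite_walks: "finite (walks n s)"
proof (induction n arbitrary: s)
  case (Suc n)
  show ?case
  proof (cases s)
    case Nil
    then have "walks (Suc n) s = {}"
      using walk_bound by (auto simp: walks_def)
    then show ?thesis by simp
  next
    case (Cons m r)
    show ?thesis unfolding Cons
      by (rule finite_subset[OF walks_Suc_subset]) (use Suc coeff_power_eq_sum_lists in auto)
  qed
qed (simp add: walks_0)

definition walk_weight :: "nat \<Rightarrow> nat list \<Rightarrow> real" where
  "walk_weight n s = (8/55) ^ n * card (walks n s)"

lemma walk_weight_Suc_le:
  "walk_weight (Suc n) (m # s) \<le> 8/55 *
     ((if m = 0 then if s = [] then 0 else walk_weight n s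
       else walk_weight n ((m - 1) # s) + (\<Sum>j = m..n. walk_weight n (j # s))) +
      (\<Sum>k\<le>n. \<Sum>ps | length ps = Suc k \<and> sum_list ps = m. walk_weight n (ps @ s)))"
proof -
  let ?P = "\<lambda>k. {ps. length ps = Suc k \<and> sum_list ps = m}"
  have fin: "finite (?P k)" for k
    using coeff_power_eq_sum_lists by blast
  let ?c = "\<lambda>s. card (walks n s)"
  have img: "card (Cons x ` walks n r) = ?c r" for x r
    by (rule card_image) simp
  define A where "A = (if m = 0 then if s = [] then {} else Cons (True, m # s) ` walks n s
      else Cons (False, m # s) ` walks n ((m - 1) # s) \<union>
        (\<Union>j\<in>{m..n}. Cons (False, m # s) ` walks n (j # s)))"
  define B where "B = (\<Union>k\<le>n. \<Union>ps\<in>?P k. Cons (True, m # s) ` walks n (ps @ s))"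
  have "card (walks (Suc n) (m # s)) \<le> card (A \<union> B)"
    unfolding A_def B_def
    by (rule card_mono[OF _ walks_Suc_subset]) (use finite_walks fin in auto)
  also have "\<dots> \<le> card A + card B" by (rule card_Un_le)
  also have "card A \<le> (if m = 0 then if s = [] then 0 else ?c s
      else ?c ((m - 1) # s) + (\<Sum>j = m..n. ?c (j # s)))"
  proof -
    have "card (\<Union>j\<in>{m..n}. Cons (False, m # s) ` walks n (j # s)) \<le> (\<Sum>j = m..n. ?c (j # s))"
      using card_UN_le[of "{m..n}" "\<lambda>j. Cons (False, m # s) ` walks n (j # s)"] by (simp add: img)
    then show ?thesis
      unfolding A_def using img[of "(False, m # s)"] img[of "(True, m # s)"]
      by (auto intro!: order_trans[OF card_Un_le] add_mono)
  qed
  also have "card B \<le> (\<Sum>k\<le>n. \<Sum>ps\<in>?P k. ?c (ps @ s))"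
  proof -
    have "card B \<le> (\<Sum>k\<le>n. card (\<Union>ps\<in>?P k. Cons (True, m # s) ` walks n (ps @ s)))"
      unfolding B_def by (rule card_UN_le) simp
    also have "\<dots> \<le> (\<Sum>k\<le>n. \<Sum>ps\<in>?P k. card (Cons (True, m # s) ` walks n (ps @ s)))"
      by (intro sum_mono card_UN_le fin)
    finally show ?thesis by (simp add: img)
  qed
  finally have "card (walks (Suc n) (m # s)) \<le> (if m = 0 then if s = [] then 0 else ?c s
      else ?c ((m - 1) # s) + (\<Sum>j = m..n. ?c (j # s))) + (\<Sum>k\<le>n. \<Sum>ps\<in>?P k. ?c (ps @ s))" (is "_ \<le> ?r")
    by simp
  then have "walk_weight (Suc n) (m # s) \<le> (8/55) ^ Suc n * real ?r"
    unfolding walk_weight_def by (intro mult_left_mono) (simp_all only: of_nat_le_iff, simp)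
  also have "\<dots> = 8/55 *
     ((if m = 0 then if s = [] then 0 else walk_weight n s
       else walk_weight n ((m - 1) # s) + (\<Sum>j = m..n. walk_weight n (j # s))) +
      (\<Sum>k\<le>n. \<Sum>ps\<in>?P k. walk_weight n (ps @ s)))"
    by (simp add: walk_weight_def sum_distrib_left distrib_left mult.assoc)
  finally show ?thesis .
qed

text \<open>The expected product form: a walk to this state splits at its pending blue entries into
  independent walks, so there is one coefficient of \<open>p\<close> per run and one
  \<open>8/55\<close> per pending blue entry.\<close>

definition run_bound :: "real poly \<Rightarrow> nat list \<Rightarrow> real" where
  "run_bound p s = (8/55) ^ (length s - 1) * prod_list (map (coeff p) s)"

lemma run_bound_nonneg: "coeff_le 0 p \<Longrightarrow> 0 \<le> run_bound p s"
  by (auto simp: run_bound_def coeff_le_def intro!: mult_nonneg_nonneg prod_list_nonneg)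

lemma run_bound_mono:
  assumes "coeff_le 0 p" "coeff_le p q"
  shows "run_bound p s \<le> run_bound q s"
proof -
  have "prod_list (map (coeff p) s) \<le> prod_list (map (coeff q) s)"
    using assms by (induction s)
      (auto simp: coeff_le_def intro!: mult_mono prod_list_nonneg intro: order_trans)
  then show ?thesis by (simp add: run_bound_def)
qed

lemma coeff_step_poly:
  "coeff (step_poly K p) m = (if m = 0 then 1 else 0) + 8/55 *
     ((if m = 0 then 0 else coeff p (m - 1) + coeff (synthetic_div p 1) (m - 1)) +
      (\<Sum>k\<le>K. (8/55) ^ k * coeff (p ^ Suc k) m))"
proof -
  have "p * (\<Sum>k\<le>K. smult (8/55) p ^ k) = (\<Sum>k\<le>K. smult ((8/55) ^ k) (p ^ Suc k))"
    by (simp add: sum_distrib_left smult_power)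
  then show ?thesis
    by (cases m) (simp_all add: step_poly_def coeff_pCons coeff_sum one_pCons)
qed

lemma walk_weight_le:
  assumes "n \<le> K" "s \<noteq> []"
  shows "walk_weight n s \<le> run_bound (run_poly K n) s"
  using assms
proof (induction n arbitrary: s)
  case 0
  have "0 \<le> run_bound 1 s" by (rule run_bound_nonneg[OF coeff_le_0_1])
  then show ?case by (simp add: walk_weight_def walks_0 run_bound_def)
next
  case (Suc n)
  let ?p = "run_poly K n"
  obtain m r where s: "s = m # r" using Suc.prems by (cases s) auto
  have IH: "walk_weight n q \<le> run_bound ?p q" if "q \<noteq> []" for q
    using Suc that by simp
  note nn = run_poly_nonneg[of n K]
  \<comment> \<open>The runs below the top contribute the common factor \<open>c\<close>; what
    remains is an inequality between coefficients of \<open>?p\<close> and of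
    \<open>step_poly K ?p\<close>.\<close>
  define c where "c = (8/55) ^ length r * prod_list (map (coeff ?p) r)"
  have c0: "0 \<le> c" using nn by (auto simp: c_def coeff_le_def intro!: mult_nonneg_nonneg prod_list_nonneg)
  have rb: "run_bound q (j # r) = coeff q j * ((8/55) ^ length r * prod_list (map (coeff q) r))" for q j
    by (simp add: run_bound_def)
  have app: "run_bound ?p (ps @ r) = (8/55) ^ k * prod_list (map (coeff ?p) ps) * c"
    if "length ps = Suc k" for ps k
    using that by (simp add: run_bound_def c_def power_add)
  have "walk_weight (Suc n) s \<le> 8/55 *
     ((if m = 0 then if r = [] then 0 else walk_weight n r
       else walk_weight n ((m - 1) # r) + (\<Sum>j = m..n. walk_weight n (j # r))) +
      (\<Sum>k\<le>n. \<Sum>ps | length ps = Suc k \<and> sum_list ps = m. walk_weight n (ps @ r)))"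
    unfolding s by (rule walk_weight_Suc_le)
  also have "\<dots> \<le> 8/55 *
     ((if m = 0 then if r = [] then 0 else run_bound ?p r
       else coeff ?p (m - 1) * c + (\<Sum>j = m..n. coeff ?p j * c)) +
      (\<Sum>k\<le>n. \<Sum>ps | length ps = Suc k \<and> sum_list ps = m. (8/55) ^ k * prod_list (map (coeff ?p) ps) * c))"
  proof -
    have "walk_weight n (j # r) \<le> coeff ?p j * c" for j
      using IH[of "j # r"] by (simp add: rb c_def)
    moreover have "walk_weight n (ps @ r) \<le> (8/55) ^ k * prod_list (map (coeff ?p) ps) * c"
      if "length ps = Suc k" for ps k
      using IH[of "ps @ r"] that app[OF that] by fastforce
    ultimately show ?thesis
      using IH[of r] by (intro mult_left_mono add_mono sum_mono) (auto intro!: add_mono sum_mono)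
  qed
  also have "(\<Sum>k\<le>n. \<Sum>ps | length ps = Suc k \<and> sum_list ps = m. (8/55) ^ k * prod_list (map (coeff ?p) ps) * c)
      = (\<Sum>k\<le>n. (8/55) ^ k * coeff (?p ^ Suc k) m) * c"
    using coeff_power_eq_sum_lists[of _ m ?p]
    by (simp add: sum_distrib_left sum_distrib_right del: power_Suc)
  also have "\<dots> \<le> (\<Sum>k\<le>K. (8/55) ^ k * coeff (?p ^ Suc k) m) * c"
  proof (intro mult_right_mono sum_mono2 c0)
    show "0 \<le> (8/55) ^ k * coeff (?p ^ Suc k) m" for k
      using coeff_le_power[OF nn coeff_le_refl, of "Suc k"] by (auto simp: coeff_le_def[of 0] simp del: power_Suc)
  qed (use Suc.prems in auto)
  also have "8/55 *
     ((if m = 0 then if r = [] then 0 else run_bound ?p r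
       else coeff ?p (m - 1) * c + (\<Sum>j = m..n. coeff ?p j * c)) +
      (\<Sum>k\<le>K. (8/55) ^ k * coeff (?p ^ Suc k) m) * c) \<le> coeff (step_poly K ?p) m * c"
  proof (cases m)
    case 0
    \<comment> \<open>A blue push onto \<open>r\<close> creates an empty run; its factor
      \<open>8/55\<close> completes \<open>c\<close>, matching the constant term 1 of
      \<open>step_poly\<close>.\<close>
    have "(if r = [] then 0 else 8/55 * run_bound ?p r) \<le> c"
      using c0 by (cases r) (auto simp: run_bound_def c_def)
    with 0 show ?thesis
      by (auto simp: coeff_step_poly algebra_simps split: if_splits)
  next
    case (Suc m')
    have "(\<Sum>j = m..n. coeff ?p j) * c \<le> coeff (synthetic_div ?p 1) m' * c"
      unfolding Suc using c0 by (intro mult_right_mono sum_coeff_le_synthetic_div nn)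
    moreover have "(\<Sum>j = m..n. coeff ?p j * c) = (\<Sum>j = m..n. coeff ?p j) * c"
      by (simp add: sum_distrib_right)
    ultimately show ?thesis
      using Suc by (simp add: coeff_step_poly algebra_simps)
  qed
  also have "\<dots> = (8/55) ^ length r * prod_list (map (coeff ?p) r) * coeff (run_poly K (Suc n)) m"
    by (simp add: c_def)
  also have "\<dots> \<le> run_bound (run_poly K (Suc n)) s"
  proof -
    have "prod_list (map (coeff ?p) r) \<le> prod_list (map (coeff (run_poly K (Suc n))) r)"
      using run_bound_mono[OF nn run_poly_Suc, of r] by (simp add: run_bound_def)
    then have "(8/55) ^ length r * prod_list (map (coeff ?p) r) * coeff (run_poly K (Suc n)) m \<le>
       (8/55) ^ length r * prod_list (map (coeff (run_poly K (Suc n))) r) * coeff (run_poly K (Suc n)) m"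
      using run_poly_nonneg[of "Suc n" K] by (intro mult_right_mono mult_left_mono) (auto simp: coeff_le_def)
    then show ?thesis unfolding s rb by (simp add: mult.commute)
  qed
  finally show ?case by simp
qed

section \<open>Walks of arc diagrams\<close>

fun runs :: "nat set \<Rightarrow> nat list \<Rightarrow> nat list" where
  "runs B [] = [0]"
| "runs B (x # xs) = (if x \<in> B then 0 # runs B xs else Suc (hd (runs B xs)) # tl (runs B xs))"

fun unpush :: "nat set \<Rightarrow> nat \<Rightarrow> nat list \<Rightarrow> nat list" where
  "unpush B k [] = []"
| "unpush B k (x # xs) = (if k = 0 then x # xs else if x \<in> B then unpush B (k - 1) xs
     else x # unpush B k xs)"

lemma runs_nonempty [simp]: "runs B xs \<noteq> []"
  by (induction xs) auto

lemma length_runs: "length (runs B xs) = Suc (length (filter (\<lambda>x. x \<in> B) xs))"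
  by (induction xs) auto

lemma runs_red_append:
  assumes "set xs \<inter> B = {}"
  shows "runs B (xs @ ys) = (length xs + hd (runs B ys)) # tl (runs B ys)"
  using assms by (induction xs) auto

text \<open>Removing the \<open>k\<close> topmost blue separators joins the top \<open>k + 1\<close>
  runs, which is the shape of \<open>blue_pop\<close>.\<close>

lemma runs_unpush:
  assumes "k \<le> length (filter (\<lambda>x. x \<in> B) xs)"
  shows "\<exists>ps s. runs B xs = ps @ s \<and> length ps = Suc k \<and> runs B (unpush B k xs) = sum_list ps # s"
  using assms
proof (induction xs arbitrary: k)
  case Nil
  then show ?case by (intro exI[of _ "[0]"] exI[of _ "[]"]) auto
next
  case (Cons x xs)
  consider "k = 0" | k' where "k = Suc k'" "x \<in> B" | "k > 0" "x \<notin> B"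
    by (cases k) auto
  then show ?case
  proof cases
    case 1
    obtain m s where "runs B (x # xs) = m # s"
      using runs_nonempty by (metis list.exhaust)
    with 1 show ?thesis
      by (intro exI[of _ "[m]"] exI[of _ s]) simp
  next
    case 2
    with Cons.prems Cons.IH[of k'] obtain ps s where
      "runs B xs = ps @ s" "length ps = Suc k'" "runs B (unpush B k' xs) = sum_list ps # s"
      by auto
    with 2 show ?thesis
      by (intro exI[of _ "0 # ps"] exI[of _ s]) simp
  next
    case 3
    with Cons.prems Cons.IH[of k] obtain ps s where
      *: "runs B xs = ps @ s" "length ps = Suc k" "runs B (unpush B k xs) = sum_list ps # s"
      by auto
    then obtain m qs where "ps = m # qs" by (cases ps) auto
    with 3 * show ?thesis
      by (intro exI[of _ "Suc m # qs"] exI[of _ s]) simp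
  qed
qed

text \<open>With the top of the stack listed first, the hypothesis makes the blue elements to be
  kept a lower segment among the blue ones, so those removed are the topmost.\<close>

lemma filter_eq_unpush:
  assumes "sorted_wrt (\<lambda>x y. x \<in> B \<and> y \<in> B \<and> keep x \<longrightarrow> keep y) xs"
  shows "filter (\<lambda>x. x \<in> B \<longrightarrow> keep x) xs =
    unpush B (length (filter (\<lambda>x. x \<in> B \<and> \<not> keep x) xs)) xs"
  using assms
proof (induction xs)
  case (Cons x xs)
  show ?case
  proof (cases "x \<in> B \<and> keep x")
    case True
    with Cons.prems have "\<forall>y\<in>set xs. y \<in> B \<longrightarrow> keep y" by auto
    then have "filter (\<lambda>x. x \<in> B \<and> \<not> keep x) (x # xs) = []"
      "filter (\<lambda>x. x \<in> B \<longrightarrow> keep x) (x # xs) = x # xs"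
      using True by (auto simp: filter_empty_conv filter_id_conv)
    then show ?thesis by (simp del: filter.simps)
  next
    case False
    show ?thesis
    proof (cases "x \<in> B")
      case True
      with False Cons show ?thesis by simp
    next
      case red: False
      have "unpush B 0 ys = ys" for ys by (cases ys) auto
      with red Cons show ?thesis by auto
    qed
  qed
qed simp

text \<open>
  \<open>B\<close> is the set of blue positions, \<open>L\<close> sends a red position to the first red one with a smaller or
  equal value, and \<open>R\<close> sends a blue position to the last blue one with a larger or equal value.
\<close>

locale diagram =
  fixes n :: nat and B :: "nat set" and L R :: "nat \<Rightarrow> nat"
  assumes B_subset: "B \<subseteq> {..<n}"
    and L_le: "\<And>i. i < n \<Longrightarrow> i \<notin> B \<Longrightarrow> L i \<le> i"
    and L_red: "\<And>i. i < n \<Longrightarrow> i \<notin> B \<Longrightarrow> L i \<notin> B"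
    and L_L: "\<And>i. i < n \<Longrightarrow> i \<notin> B \<Longrightarrow> L (L i) = L i"
    and L_noncrossing: "\<And>i j. i < n \<Longrightarrow> i \<notin> B \<Longrightarrow> j \<notin> B \<Longrightarrow> j < i \<Longrightarrow> L i < j \<Longrightarrow> L i \<le> L j"
    and R_ge: "\<And>i. i \<in> B \<Longrightarrow> i \<le> R i"
    and R_blue: "\<And>i. i \<in> B \<Longrightarrow> R i \<in> B"
    and R_R: "\<And>i. i \<in> B \<Longrightarrow> R (R i) = R i"
    and R_noncrossing: "\<And>i j. i \<in> B \<Longrightarrow> j \<in> B \<Longrightarrow> i < j \<Longrightarrow> j \<le> R i \<Longrightarrow> R j \<le> R i"
    and no_cross: "\<And>i j. i \<in> B \<Longrightarrow> j < n \<Longrightarrow> j \<notin> B \<Longrightarrow> L j < i \<Longrightarrow> i < j \<Longrightarrow> R i < j"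
begin

text \<open>
  At time \<open>i\<close> (positions below \<open>i\<close> have been read) a blue position is live if its arc is still open; a
  red left-to-right minimum is live if a later red entry may still be joined to it.
\<close>

definition live :: "nat \<Rightarrow> nat \<Rightarrow> bool" where
  "live i x \<longleftrightarrow> (if x \<in> B then i \<le> R x else L x = x \<and> (\<forall>j. x < j \<and> j < i \<and> j \<notin> B \<longrightarrow> x \<le> L j))"

definition stack :: "nat \<Rightarrow> nat list" where
  "stack i = filter (live i) (rev [0..<i])"

definition state :: "nat \<Rightarrow> nat list" where
  "state i = runs B (stack i)"

primrec history :: "nat \<Rightarrow> (bool \<times> nat list) list" where
  "history 0 = []"
| "history (Suc i) = (i \<in> B, state (Suc i)) # history i"

lemma set_stack: "set (stack i) = {x. x < i \<and> live i x}"
  by (auto simp: stack_def)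

lemma stack_push:
  assumes "live (Suc i) i" "\<And>x. x < i \<Longrightarrow> live (Suc i) x = live i x"
  shows "stack (Suc i) = i # stack i"
  using assms by (auto simp: stack_def intro!: filter_cong)

text \<open>If \<open>L i\<close> differs from \<open>i\<close>, the stack is cut down to
  \<open>L i\<close>: a live blue entry above \<open>L i\<close> would have an arc crossing that of
  \<open>i\<close>, against \<open>no_cross\<close>, and the red entries above \<open>L i\<close>
  are no longer live.\<close>

lemma stack_Suc_red:
  assumes "i < n" "i \<notin> B"
  shows "if L i = i then stack (Suc i) = i # stack i
    else \<exists>ys zs. stack i = ys @ L i # zs \<and> stack (Suc i) = L i # zs \<and> set ys \<inter> B = {}"
proof (cases "L i = i")
  case True
  have "stack (Suc i) = i # stack i"
  proof (rule stack_push)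
    show "live (Suc i) i" using True assms by (simp add: live_def)
    show "live (Suc i) x = live i x" if "x < i" for x
      using that True assms R_blue[of x]
      by (auto simp: live_def less_Suc_eq Suc_le_eq le_less)
  qed
  with True show ?thesis by simp
next
  case False
  then have Li: "L i < i" "L i \<notin> B"
    using assms L_le[of i] L_red[of i] by auto
  \<comment> \<open>By \<open>L_noncrossing\<close>, no red entry between \<open>L i\<close> and
    \<open>i\<close> is joined to a position before \<open>L i\<close>.\<close>
  have "live i (L i)"
    using assms Li L_L L_noncrossing[of i] by (auto simp: live_def)
  then have mem: "live (Suc i) (L i)"
    using assms Li L_L by (auto simp: live_def less_Suc_eq)
  have keep: "live (Suc i) x \<longleftrightarrow> live i x \<and> x \<le> L i" if "x < i" for x
  proof (cases "x \<in> B")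
    case True
    have "x < L i \<or> L i < x" using True Li by (metis nat_neq_iff)
    with True that assms no_cross[of x i] R_blue[of x] show ?thesis
      by (auto simp: live_def not_le Suc_le_eq le_less)
  next
    case False
    with that assms show ?thesis by (auto simp: live_def less_Suc_eq)
  qed
  have split: "rev [0..<i] = rev [Suc (L i)..<i] @ L i # rev [0..<L i]"
  proof -
    have "[0..<i] = [0..<L i] @ [L i..<i]" using Li
      by (metis le_add_diff_inverse less_imp_le upt_add_eq_append zero_le)
    then show ?thesis using Li by (simp add: upt_conv_Cons)
  qed
  let ?ys = "filter (live i) (rev [Suc (L i)..<i])" and ?zs = "filter (live i) (rev [0..<L i])"
  have 1: "stack i = ?ys @ L i # ?zs"
    unfolding stack_def split using \<open>live i (L i)\<close> by simp
  have "stack (Suc i) = filter (live (Suc i)) (rev [0..<i])"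
  proof -
    have "\<not> live (Suc i) i" using False assms by (simp add: live_def)
    then show ?thesis by (simp add: stack_def)
  qed
  also have "\<dots> = filter (live (Suc i)) (rev [Suc (L i)..<i]) @ L i # filter (live (Suc i)) (rev [0..<L i])"
    unfolding split using mem by simp
  also have "filter (live (Suc i)) (rev [Suc (L i)..<i]) = []"
    using keep by (auto simp: filter_empty_conv)
  also have "filter (live (Suc i)) (rev [0..<L i]) = ?zs"
    using keep Li by (intro filter_cong) auto
  finally have 2: "stack (Suc i) = L i # ?zs" by simp
  have "x \<notin> B" if "x \<in> set ?ys" for x
  proof
    assume "x \<in> B"
    with that no_cross[of x i] assms show False by (auto simp: live_def)
  qed
  with 1 2 False show ?thesis by auto
qed

text \<open>By \<open>R_R\<close>, an entry with \<open>R i > i\<close> ends no arc, so nothing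
  leaves the stack. An entry with \<open>R i = i\<close> closes the live arcs ending at
  \<open>i\<close>; by \<open>R_noncrossing\<close> these belong to the topmost blue
  entries.\<close>

lemma stack_Suc_blue:
  assumes "i \<in> B"
  shows "if R i > i then stack (Suc i) = i # stack i
    else stack (Suc i) = unpush B (length (state i) - length (state (Suc i))) (stack i) \<and>
      length (state (Suc i)) \<le> length (state i)"
proof (cases "R i > i")
  case True
  have "stack (Suc i) = i # stack i"
  proof (rule stack_push)
    show "live (Suc i) i" using True assms by (simp add: live_def)
    show "live (Suc i) x = live i x" if "x < i" for x
    proof (cases "x \<in> B")
      case x: True
      have "R x \<noteq> i" using R_R[OF x] True by auto
      with x show ?thesis by (auto simp: live_def)
    next
      case False
      with assms show ?thesis by (auto simp: live_def less_Suc_eq)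
    qed
  qed
  with True show ?thesis by simp
next
  case False
  let ?keep = "\<lambda>x. i < R x"
  let ?gone = "length (filter (\<lambda>x. x \<in> B \<and> \<not> ?keep x) (stack i))"
  have keep: "live (Suc i) x \<longleftrightarrow> live i x \<and> (x \<in> B \<longrightarrow> ?keep x)" if "x < i" for x
    using assms by (auto simp: live_def less_Suc_eq)
  have "\<not> live (Suc i) i" using False assms by (simp add: live_def)
  then have "stack (Suc i) = filter (live (Suc i)) (rev [0..<i])"
    by (simp add: stack_def)
  also have "\<dots> = filter (\<lambda>x. x \<in> B \<longrightarrow> ?keep x) (stack i)"
    unfolding stack_def filter_filter using keep by (intro filter_cong) auto
  finally have eq: "stack (Suc i) = filter (\<lambda>x. x \<in> B \<longrightarrow> ?keep x) (stack i)" .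
  have "sorted_wrt (\<lambda>x y. x \<in> B \<and> y \<in> B \<and> ?keep x \<longrightarrow> ?keep y) (stack i)"
  proof -
    have "sorted_wrt (>) (rev [0..<i])"
      by (simp add: sorted_wrt_rev)
    then have "sorted_wrt (>) (stack i)"
      unfolding stack_def by (rule sorted_wrt_filter)
    then show ?thesis
    proof (rule sorted_wrt_mono_rel[rotated])
      fix x y assume xy: "x \<in> set (stack i)" "y \<in> set (stack i)" "x > y"
      show "x \<in> B \<and> y \<in> B \<and> ?keep x \<longrightarrow> ?keep y"
        using xy R_noncrossing[of y x] by (auto simp: set_stack live_def)
    qed
  qed
  from filter_eq_unpush[OF this] have un: "stack (Suc i) = unpush B ?gone (stack i)"
    unfolding eq .
  have "length (filter (\<lambda>x. x \<in> B) (stack i)) = ?gone + length (filter (\<lambda>x. x \<in> B) (stack (Suc i)))"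
  proof -
    have "length (filter (\<lambda>x. x \<in> B) xs) = length (filter (\<lambda>x. x \<in> B \<and> \<not> ?keep x) xs) +
      length (filter (\<lambda>x. x \<in> B) (filter (\<lambda>x. x \<in> B \<longrightarrow> ?keep x) xs))" for xs
      by (induction xs) auto
    then show ?thesis unfolding eq .
  qed
  then have "length (state i) = ?gone + length (state (Suc i))"
    by (simp add: state_def length_runs)
  with un False show ?thesis by simp
qed

lemma run_step_state:
  assumes "i < n"
  shows "run_step (i \<in> B) (state i) (state (Suc i))"
proof (cases "i \<in> B")
  case True
  note st = stack_Suc_blue[OF True]
  show ?thesis
  proof (cases "R i > i")
    case push: True
    with st have "stack (Suc i) = i # stack i" by simp
    with True show ?thesis by (simp add: state_def blue_push)
  next
    case False
    define k where "k = length (state i) - length (state (Suc i))"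
    have un: "stack (Suc i) = unpush B k (stack i)" using st False by (simp add: k_def)
    have "k \<le> length (filter (\<lambda>x. x \<in> B) (stack i))"
      by (simp add: k_def state_def length_runs)
    then obtain ps s where "runs B (stack i) = ps @ s" "length ps = Suc k"
        "runs B (unpush B k (stack i)) = sum_list ps # s"
      using runs_unpush by blast
    then have "state i = ps @ s" "state (Suc i) = sum_list ps # s" "ps \<noteq> []"
      by (auto simp: state_def un)
    with True show ?thesis by (auto intro: blue_pop)
  qed
next
  case False
  note st = stack_Suc_red[OF assms False]
  show ?thesis
  proof (cases "L i = i")
    case True
    with st have *: "stack (Suc i) = i # stack i" by simp
    obtain m s where "state i = m # s" by (metis list.exhaust runs_nonempty state_def)
    with * False show ?thesis by (simp add: state_def red_push)
  next
    case pop: False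
    with st obtain ys zs where *: "stack i = ys @ L i # zs" "stack (Suc i) = L i # zs" "set ys \<inter> B = {}"
      by auto
    have "L i \<notin> B" using L_red assms False by blast
    with * False show ?thesis
      by (auto simp: state_def runs_red_append intro!: red_pop)
  qed
qed

lemma walk_history: "i \<le> n \<Longrightarrow> walk (history i) (state i)"
proof (induction i)
  case 0
  then show ?case by (simp add: state_def stack_def walk_Nil)
next
  case (Suc i)
  then show ?case using run_step_state[of i] by (auto intro: walk_Cons)
qed

lemma length_history [simp]: "length (history i) = i"
  by (induction i) auto

text \<open>\<open>R\<close> maps \<open>B\<close> into itself and \<open>B\<close> lies below
  \<open>n\<close>, so no arc is open at time \<open>n\<close> and a single run remains.\<close>

lemma state_final: "\<exists>m\<le>n. state n = [m]"
proof -
  have "x \<notin> B" if "x \<in> set (stack n)" for x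
    using that R_blue[of x] B_subset by (auto simp: set_stack live_def)
  then have "length (state n) = 1"
    by (simp add: state_def length_runs filter_empty_conv)
  then obtain m where m: "state n = [m]" by (auto simp: length_Suc_conv)
  with walk_bound[OF walk_history[of n]] show ?thesis by auto
qed

lemma history_mem: "\<exists>m\<le>n. history n \<in> walks n [m]"
  using state_final walk_history[of n] by (auto simp: walks_def)

text \<open>
  The right-hand side depends only on the history and the previous stack, so the history determines
  all stacks, and these determine \<open>L\<close> and \<open>R\<close>.
\<close>

lemma stack_Suc_eq:
  assumes "i < n"
  shows "stack (Suc i) =
    (if i \<in> B then
       if length (state (Suc i)) > length (state i) then i # stack i
       else unpush B (length (state i) - length (state (Suc i))) (stack i)
     else
       if hd (state (Suc i)) > hd (state i) then i # stack i
       else drop (hd (state i) - hd (state (Suc i))) (stack i))"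
proof (cases "i \<in> B")
  case True
  show ?thesis
  proof (cases "R i > i")
    case push: True
    with stack_Suc_blue[OF True] True show ?thesis by (simp add: state_def)
  next
    case False
    with stack_Suc_blue[OF True] True show ?thesis by simp
  qed
next
  case False
  note st = stack_Suc_red[OF assms False]
  show ?thesis
  proof (cases "L i = i")
    case True
    with st False show ?thesis by (simp add: state_def)
  next
    case pop: False
    with st obtain ys zs where *: "stack i = ys @ L i # zs" "stack (Suc i) = L i # zs" "set ys \<inter> B = {}"
      by auto
    have "hd (state i) = length ys + hd (state (Suc i))"
      using * by (simp add: state_def runs_red_append)
    with * False show ?thesis by simp
  qed
qed

lemma L_eq_hd:
  assumes "i < n" "i \<notin> B"
  shows "L i = hd (stack (Suc i))"
  using stack_Suc_red[OF assms] by (auto split: if_splits)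

lemma le_R_iff:
  assumes "x \<in> B" "x < i"
  shows "i \<le> R x \<longleftrightarrow> x \<in> set (stack i)"
  using assms by (auto simp: set_stack live_def)

end

lemma diagram_eqI:
  assumes "diagram n B L R" "diagram n B' L' R'"
    and hist: "diagram.history B L R n = diagram.history B' L' R' n"
  shows "B = B' \<and> (\<forall>i<n. i \<notin> B \<longrightarrow> L i = L' i) \<and> (\<forall>i\<in>B. R i = R' i)"
proof -
  interpret D: diagram n B L R by fact
  interpret D': diagram n B' L' R' by fact
  have h: "D.history i = D'.history i" if "i \<le> n" for i
    using that hist by (induction i rule: inc_induct) auto
  have col: "i \<in> B \<longleftrightarrow> i \<in> B'" if "i < n" for i
    using h[of "Suc i"] that by simp
  then have B: "B = B'" using D.B_subset D'.B_subset by blast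
  have st: "D.state i = D'.state i" if "i \<le> n" for i
    using h[of i] that by (cases i) (auto simp: D.state_def D'.state_def D.stack_def D'.stack_def)
  have stk: "D.stack i = D'.stack i" if "i \<le> n" for i
    using that
  proof (induction i)
    case (Suc i)
    then have "i < n" by simp
    show ?case
      unfolding D.stack_Suc_eq[OF \<open>i < n\<close>] D'.stack_Suc_eq[OF \<open>i < n\<close>]
      using Suc st[of i] st[of "Suc i"] B by simp
  qed (simp add: D.stack_def D'.stack_def)
  have "L i = L' i" if "i < n" "i \<notin> B" for i
    using that stk[of "Suc i"] D.L_eq_hd[of i] D'.L_eq_hd[of i] B by simp
  moreover have "R x = R' x" if x: "x \<in> B" for x
  proof -
    \<comment> \<open>\<open>R x\<close> is the last time at which \<open>x\<close> is on the stack,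
      or \<open>x\<close> itself if it never gets there.\<close>
    have le: "i \<le> R x \<longleftrightarrow> i \<le> R' x" if "x < i" "i \<le> n" for i
      using that x stk[of i] D.le_R_iff[of x i] D'.le_R_iff[of x i] B by simp
    have bounds: "x \<le> R x" "R x < n" "x \<le> R' x" "R' x < n"
      using x B D.R_ge D.R_blue D.B_subset D'.R_ge D'.R_blue D'.B_subset by blast+
    show ?thesis
      using le[of "R x"] le[of "R' x"] bounds by linarith
  qed
  ultimately show ?thesis using B by blast
qed

section \<open>Arc diagrams of permutations\<close>

definition merge_colouring :: "nat \<Rightarrow> nat list \<Rightarrow> nat set \<Rightarrow> bool" where
  "merge_colouring n p B \<longleftrightarrow> B \<subseteq> {..<n} \<and>
     (\<forall>i j k. i < j \<and> j < k \<and> k < n \<and> i \<notin> B \<and> j \<notin> B \<and> k \<notin> B \<longrightarrow> \<not> (p ! i < p ! k \<and> p ! k < p ! j)) \<and>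
     (\<forall>i j k. i < j \<and> j < k \<and> i \<in> B \<and> j \<in> B \<and> k \<in> B \<longrightarrow> \<not> (p ! j < p ! i \<and> p ! i < p ! k)) \<and>
     (\<forall>i j. i < j \<and> j < n \<and> i \<in> B \<and> j \<notin> B \<longrightarrow> p ! j < p ! i)"

lemma merge_colouringD:
  assumes "merge_colouring n p B"
  shows "B \<subseteq> {..<n}"
    and "\<And>i j k. i < j \<Longrightarrow> j < k \<Longrightarrow> k < n \<Longrightarrow> i \<notin> B \<Longrightarrow> j \<notin> B \<Longrightarrow> k \<notin> B \<Longrightarrow>
      p ! i < p ! k \<Longrightarrow> p ! k < p ! j \<Longrightarrow> False"
    and "\<And>i j k. i < j \<Longrightarrow> j < k \<Longrightarrow> i \<in> B \<Longrightarrow> j \<in> B \<Longrightarrow> k \<in> B \<Longrightarrow>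
      p ! j < p ! i \<Longrightarrow> p ! i < p ! k \<Longrightarrow> False"
    and "\<And>i j. i < j \<Longrightarrow> j < n \<Longrightarrow> i \<in> B \<Longrightarrow> j \<notin> B \<Longrightarrow> p ! j < p ! i"
  using assms by (simp_all add: merge_colouring_def)

primrec blues :: "nat list \<Rightarrow> nat \<Rightarrow> nat set" where
  "blues p 0 = {}"
| "blues p (Suc n) =
     (if (\<exists>b\<in>blues p n. p ! b < p ! n) \<or>
         (\<exists>i j. i < j \<and> j < n \<and> i \<notin> blues p n \<and> j \<notin> blues p n \<and> p ! i < p ! n \<and> p ! n < p ! j)
      then insert n (blues p n) else blues p n)"

lemma blues_subset: "blues p n \<subseteq> {..<n}"
  by (induction n) auto

lemma blues_restrict:
  assumes "m \<le> n" "i < m"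
  shows "i \<in> blues p n \<longleftrightarrow> i \<in> blues p m"
  using assms by (induction n rule: dec_induct) auto

text \<open>A colour never changes once its position is read, so the recursive rule can be stated
  with the final set of blue positions.\<close>

lemma blues_iff:
  assumes "k < n"
  shows "k \<in> blues p n \<longleftrightarrow> (\<exists>b<k. b \<in> blues p n \<and> p ! b < p ! k) \<or>
    (\<exists>i j. i < j \<and> j < k \<and> i \<notin> blues p n \<and> j \<notin> blues p n \<and> p ! i < p ! k \<and> p ! k < p ! j)"
proof -
  have r: "i \<in> blues p n \<longleftrightarrow> i \<in> blues p k" if "i < k" for i
    using that assms by (intro blues_restrict) auto
  have "k \<in> blues p n \<longleftrightarrow> k \<in> blues p (Suc k)"
    using assms by (intro blues_restrict) auto
  also have "\<dots> \<longleftrightarrow> (\<exists>b\<in>blues p k. p ! b < p ! k) \<or>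
         (\<exists>i j. i < j \<and> j < k \<and> i \<notin> blues p k \<and> j \<notin> blues p k \<and> p ! i < p ! k \<and> p ! k < p ! j)"
    using blues_subset[of p k] by auto
  also have "(\<exists>b\<in>blues p k. p ! b < p ! k) \<longleftrightarrow> (\<exists>b<k. b \<in> blues p n \<and> p ! b < p ! k)"
    using blues_subset[of p k] r by auto
  also have "(\<exists>i j. i < j \<and> j < k \<and> i \<notin> blues p k \<and> j \<notin> blues p k \<and> p ! i < p ! k \<and> p ! k < p ! j) \<longleftrightarrow>
    (\<exists>i j. i < j \<and> j < k \<and> i \<notin> blues p n \<and> j \<notin> blues p n \<and> p ! i < p ! k \<and> p ! k < p ! j)"
    using r by (meson less_trans)
  finally show ?thesis .
qed

lemma avoids_1324D:
  assumes "avoids_1324 p" "a < b" "b < c" "c < d" "d < length p"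
    and "p ! a < p ! c" "p ! c < p ! b" "p ! b < p ! d"
  shows False
proof -
  have "\<exists>i1 i2 i3 i4. i1 < i2 \<and> i2 < i3 \<and> i3 < i4 \<and> i4 < length p \<and>
      p ! i1 < p ! i3 \<and> p ! i3 < p ! i2 \<and> p ! i2 < p ! i4"
    using assms by (intro exI[of _ a] exI[of _ b] exI[of _ c] exI[of _ d]) simp
  with assms(1) show False unfolding avoids_1324_def by contradiction
qed

text \<open>Only the avoidance of 213 by the blues needs work. Given a blue 213 at \<open>i\<close>,
  \<open>j\<close>, \<open>k\<close>, the first blue \<open>b\<close> of value at most
  \<open>p ! j\<close> has no smaller blue before it, so it completes a 132 \<open>x\<close>,
  \<open>y\<close>, \<open>b\<close> with \<open>x\<close>, \<open>y\<close> red. If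
  \<open>x < i\<close>, then \<open>x\<close>, \<open>i\<close>, \<open>j\<close>, \<open>k\<close>
  is a 1324; otherwise \<open>p ! y < p ! i\<close> by \<open>cross\<close>, and \<open>x\<close>,
  \<open>y\<close>, \<open>b\<close>, \<open>k\<close> is one.\<close>

lemma merge_colouring_blues:
  assumes "distinct p" "length p = n" "avoids_1324 p"
  shows "merge_colouring n p (blues p n)"
proof -
  let ?B = "blues p n"
  have red: "\<not> (p ! i < p ! k \<and> p ! k < p ! j)"
    if "i < j" "j < k" "k < n" "i \<notin> ?B" "j \<notin> ?B" "k \<notin> ?B" for i j k
    using that blues_iff[of k n p] by blast
  have cross: "p ! j < p ! i" if "i < j" "j < n" "i \<in> ?B" "j \<notin> ?B" for i j
  proof -
    have "p ! i \<noteq> p ! j" using that assms by (simp add: nth_eq_iff_index_eq)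
    moreover have "\<not> p ! i < p ! j" using that blues_iff[of j n p] by blast
    ultimately show ?thesis by simp
  qed
  have blue: "\<not> (p ! j < p ! i \<and> p ! i < p ! k)"
    if ijk: "i < j" "j < k" "i \<in> ?B" "j \<in> ?B" "k \<in> ?B" for i j k
  proof
    assume p: "p ! j < p ! i \<and> p ! i < p ! k"
    have kn: "k < n" using ijk blues_subset[of p n] by auto
    define b where "b = (LEAST b. b \<in> ?B \<and> p ! b \<le> p ! j)"
    have b: "b \<in> ?B" "p ! b \<le> p ! j"
      using LeastI[of "\<lambda>b. b \<in> ?B \<and> p ! b \<le> p ! j" j] ijk by (auto simp: b_def)
    have bj: "b \<le> j" unfolding b_def using ijk by (intro Least_le) auto
    have "\<not> (\<exists>c<b. c \<in> ?B \<and> p ! c < p ! b)"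
      using not_less_Least[of _ "\<lambda>b. b \<in> ?B \<and> p ! b \<le> p ! j"] b by (fastforce simp: b_def[symmetric])
    with blues_iff[of b n p] b bj ijk kn obtain x y where
      xy: "x < y" "y < b" "x \<notin> ?B" "y \<notin> ?B" "p ! x < p ! b" "p ! b < p ! y"
      by auto
    have "x \<noteq> i" using xy ijk by auto
    then consider "x < i" | "i < x" by linarith
    then show False
    proof cases
      case 1
      then show False
        using avoids_1324D[OF assms(3), of x i j k] ijk kn p xy b assms(2) by simp
    next
      case 2
      then have "p ! y < p ! i" using cross[of i y] xy bj ijk kn by simp
      then show False
        using avoids_1324D[OF assms(3), of x y b k] ijk kn p xy b bj assms(2) by simp
    qed
  qed
  show ?thesis
    unfolding merge_colouring_def
    by (intro conjI allI impI; (elim conjE)?) (use blues_subset[of p n] red cross blue in blast)+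
qed

section \<open>Arcs of a coloured permutation\<close>

definition first_below :: "nat list \<Rightarrow> nat set \<Rightarrow> nat \<Rightarrow> nat" where
  "first_below p B i = (LEAST j. j \<notin> B \<and> p ! j \<le> p ! i)"

definition last_above :: "nat list \<Rightarrow> nat set \<Rightarrow> nat \<Rightarrow> nat" where
  "last_above p B i = Max {j \<in> B. p ! i \<le> p ! j}"

text \<open>The position \<open>i\<close> itself satisfies the condition, so the minimum is attained
  at or before \<open>i\<close> and never depends on indices beyond the list when \<open>i\<close>
  lies in it.\<close>

lemma first_below:
  assumes "i \<notin> B"
  shows "first_below p B i \<le> i" "first_below p B i \<notin> B" "p ! first_below p B i \<le> p ! i"
    and "\<And>j. j \<notin> B \<Longrightarrow> p ! j \<le> p ! i \<Longrightarrow> first_below p B i \<le> j"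
  using LeastI[of "\<lambda>j. j \<notin> B \<and> p ! j \<le> p ! i" i] assms
  by (auto simp: first_below_def intro: Least_le)

lemma last_above:
  assumes "i \<in> B" "finite B"
  shows "i \<le> last_above p B i" "last_above p B i \<in> B" "p ! i \<le> p ! last_above p B i"
    and "\<And>j. j \<in> B \<Longrightarrow> p ! i \<le> p ! j \<Longrightarrow> j \<le> last_above p B i"
proof -
  have "last_above p B i \<in> {j \<in> B. p ! i \<le> p ! j}"
    unfolding last_above_def using assms by (intro Max_in) auto
  then show "last_above p B i \<in> B" "p ! i \<le> p ! last_above p B i" by auto
  show "i \<le> last_above p B i"
    unfolding last_above_def using assms by (intro Max_ge) auto
  show "j \<le> last_above p B i" if "j \<in> B" "p ! i \<le> p ! j" for j
    unfolding last_above_def using assms that by (intro Max_ge) auto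
qed

text \<open>A violation of \<open>L_noncrossing\<close> gives a red 132, one of
  \<open>R_noncrossing\<close> a blue 213, and one of \<open>no_cross\<close> a 1324 at
  \<open>?L j\<close>, \<open>i\<close>, \<open>j\<close>, \<open>?R i\<close>.\<close>

lemma diagram_of_perm:
  assumes "distinct p" "length p = n" "avoids_1324 p" and mc: "merge_colouring n p B"
  shows "diagram n B (first_below p B) (last_above p B)"
proof -
  let ?L = "first_below p B" and ?R = "last_above p B"
  have sub: "B \<subseteq> {..<n}" using mc by (simp add: merge_colouring_def)
  then have fin: "finite B" by (rule finite_subset) simp
  note red = merge_colouringD(2)[OF mc] and blue = merge_colouringD(3)[OF mc]
    and cross = merge_colouringD(4)[OF mc]
  have dist: "p ! i \<noteq> p ! j" if "i \<noteq> j" "i < n" "j < n" for i j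
    using assms that by (simp add: nth_eq_iff_index_eq)
  note L = first_below[where p = p and B = B] and R = last_above[OF _ fin, where p = p]
  show ?thesis
  proof
    show "B \<subseteq> {..<n}" by fact
    show "?L i \<le> i" "?L i \<notin> B" if "i \<notin> B" for i
      using L that by auto
    show "?L (?L i) = ?L i" if "i \<notin> B" for i
        using L[OF that] L[OF L(2)[OF that]] by (meson order.trans order.antisym)
    show "?L i \<le> ?L j" if i: "i < n" "i \<notin> B" and j: "j \<notin> B" "j < i" "?L i < j" for i j
    proof (rule ccontr)
      assume "\<not> ?L i \<le> ?L j"
      then have "p ! i < p ! ?L j" using L(4)[OF i(2), of "?L j"] L(2)[OF j(1)] by fastforce
      then have "p ! i < p ! j" using L(3)[OF j(1)] by simp
      moreover have "p ! ?L i < p ! i"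
        using L(3)[OF i(2)] dist[of "?L i" i] i j by fastforce
      ultimately show False using red[of "?L i" j i] i j L(2)[OF i(2)] \<open>p ! i < p ! j\<close> by simp
    qed
    show "i \<le> ?R i" "?R i \<in> B" if "i \<in> B" for i
      using R that by auto
    show "?R (?R i) = ?R i" if "i \<in> B" for i
        using R[OF that] R[OF R(2)[OF that]] by (meson order.trans order.antisym)
    show "?R j \<le> ?R i" if i: "i \<in> B" and j: "j \<in> B" "i < j" "j \<le> ?R i" for i j
    proof (rule ccontr)
      assume "\<not> ?R j \<le> ?R i"
      then have "p ! ?R j < p ! i" using R(4)[OF i, of "?R j"] R(2)[OF j(1)] by fastforce
      then have ji: "p ! j < p ! i" using R(3)[OF j(1)] by simp
      then have "j \<noteq> ?R i" using R(3)[OF i] by auto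
      moreover have "p ! i < p ! ?R i"
        using R(2,3)[OF i] dist[of "?R i" i] i j sub by fastforce
      ultimately show False using blue[of i j "?R i"] i j ji R(2)[OF i] by simp
    qed
    show "?R i < j" if i: "i \<in> B" and j: "j < n" "j \<notin> B" "?L j < i" "i < j" for i j
    proof (rule ccontr)
      assume "\<not> ?R i < j"
      then have "j < ?R i" using j(2) R(2)[OF i] by (metis linorder_neqE_nat)
      have "p ! ?L j < p ! j" using L(3)[OF j(2)] dist[of "?L j" j] j by fastforce
      moreover have "p ! j < p ! i" using cross i j by blast
      moreover have "p ! i < p ! ?R i"
        using R(2,3)[OF i] dist[of "?R i" i] \<open>j < ?R i\<close> i j sub by fastforce
      moreover have "?R i < length p" using R(2)[OF i] sub assms(2) by auto
      ultimately show False
        using avoids_1324D[OF assms(3), of "?L j" i j "?R i"] j \<open>j < ?R i\<close> by simp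
    qed
  qed
qed

section \<open>Reconstruction of the permutation\<close>

lemma order_embedding_unique:
  fixes f g :: "nat \<Rightarrow> nat"
  assumes "finite I" "inj_on f I" "inj_on g I" "f ` I = g ` I"
    and "\<And>i j. i \<in> I \<Longrightarrow> j \<in> I \<Longrightarrow> f i < f j \<longleftrightarrow> g i < g j"
    and "i \<in> I"
  shows "f i = g i"
proof -
  \<comment> \<open>The rank of \<open>h i\<close> in the image depends only on the order relation
    between indices, and in a given finite set the rank determines the value.\<close>
  have rank: "card {v \<in> h ` I. v < h i} = card {j \<in> I. h j < h i}" if "inj_on h I" for h :: "nat \<Rightarrow> nat"
  proof -
    have "{v \<in> h ` I. v < h i} = h ` {j \<in> I. h j < h i}" by auto
    then show ?thesis using that by (simp add: card_image inj_on_subset)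
  qed
  have eq: "card {v \<in> f ` I. v < f i} = card {v \<in> f ` I. v < g i}"
    using rank[OF assms(2)] rank[OF assms(3)] assms(4-6) by (simp cong: conj_cong)
  have strict: "card {v \<in> f ` I. v < a} < card {v \<in> f ` I. v < b}" if "a < b" "a \<in> f ` I" for a b
    using that assms(1) by (intro psubset_card_mono) auto
  have "f i \<in> f ` I" "g i \<in> f ` I" using assms(4,6) by auto
  with strict[of "f i" "g i"] strict[of "g i" "f i"] eq show ?thesis
    by (metis less_irrefl linorder_neqE_nat)
qed

text \<open>If \<open>first_below p B j \<le> i\<close> but \<open>p ! j < p ! i\<close>, then
  \<open>first_below p B j\<close>, \<open>i\<close>, \<open>j\<close> carry a red 132. So the arcs
  determine the relative order of the reds.\<close>

lemma red_order:
  assumes "distinct p" "length p = n" and mc: "merge_colouring n p B"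
    and "i < j" "j < n" "i \<notin> B" "j \<notin> B"
  shows "p ! i < p ! j \<longleftrightarrow> first_below p B j \<le> i"
proof
  show "first_below p B j \<le> i" if "p ! i < p ! j"
    using that assms by (intro first_below(4)) auto
  assume le: "first_below p B j \<le> i"
  show "p ! i < p ! j"
  proof (rule ccontr)
    assume "\<not> p ! i < p ! j"
    moreover have ne: "p ! k \<noteq> p ! j" if "k < j" for k
      using that assms by (simp add: nth_eq_iff_index_eq)
    ultimately have gt: "p ! j < p ! i" using assms(4) by (meson linorder_neqE_nat)
    let ?k = "first_below p B j"
    have k: "p ! ?k \<le> p ! j" "?k \<notin> B" using first_below assms by auto
    with ne[of ?k] le assms(4) have "p ! ?k < p ! j" by simp
    moreover have "?k < i" using gt k le by (metis leD le_neq_implies_less)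
    ultimately show False
      using merge_colouringD(2)[OF mc, of ?k i j] gt k assms by simp
  qed
qed

text \<open>The mirror image of \<open>red_order\<close>: a failure would make \<open>i\<close>,
  \<open>j\<close>, \<open>last_above p B i\<close> a blue 213.\<close>

lemma blue_order:
  assumes "distinct p" "length p = n" and mc: "merge_colouring n p B"
    and "i < j" "i \<in> B" "j \<in> B"
  shows "p ! i < p ! j \<longleftrightarrow> j \<le> last_above p B i"
proof
  have sub: "B \<subseteq> {..<n}" using mc by (simp add: merge_colouring_def)
  then have fin: "finite B" by (rule finite_subset) simp
  show "j \<le> last_above p B i" if "p ! i < p ! j"
    using that assms fin by (intro last_above(4)) auto
  assume le: "j \<le> last_above p B i"
  show "p ! i < p ! j"
  proof (rule ccontr)
    assume "\<not> p ! i < p ! j"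
    moreover have ne: "p ! i \<noteq> p ! k" if "i < k" "k \<in> B" for k
      using that assms sub by (auto simp: nth_eq_iff_index_eq subset_iff)
    ultimately have gt: "p ! j < p ! i" using assms(4,6) by (meson linorder_neqE_nat)
    let ?k = "last_above p B i"
    have k: "p ! i \<le> p ! ?k" "?k \<in> B" using last_above fin assms by auto
    with ne[of ?k] le assms(4) have "p ! i < p ! ?k" by simp
    moreover have "j < ?k" using gt k le by (metis leD le_neq_implies_less)
    ultimately show False
      using merge_colouringD(3)[OF mc, of i j ?k] gt k assms by simp
  qed
qed

text \<open>The arcs fix the relative order inside each colour, and the value sets of the two
  colours turn relative order into values.\<close>

lemma perm_eqI:
  assumes p: "distinct p" "length p = n" "merge_colouring n p B"
    and q: "distinct q" "length q = n" "merge_colouring n q B"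
    and "set p = set q" "(!) p ` B = (!) q ` B"
    and L: "\<And>i. i < n \<Longrightarrow> i \<notin> B \<Longrightarrow> first_below p B i = first_below q B i"
    and R: "\<And>i. i \<in> B \<Longrightarrow> last_above p B i = last_above q B i"
  shows "p = q"
proof (rule nth_equalityI)
  fix i assume "i < length p"
  then have i: "i < n" using p by simp
  have sub: "B \<subseteq> {..<n}" using p by (simp add: merge_colouring_def)
  have inj: "inj_on ((!) p) {..<n}" "inj_on ((!) q) {..<n}"
    using p q by (auto intro!: inj_on_nth)
  have lessI: "\<forall>i\<in>I. \<forall>j\<in>I. p ! i < p ! j \<longleftrightarrow> q ! i < q ! j"
    if I: "I \<subseteq> {..<n}" and *: "\<And>i j. i \<in> I \<Longrightarrow> j \<in> I \<Longrightarrow> i < j \<Longrightarrow> p ! i < p ! j \<longleftrightarrow> q ! i < q ! j" for I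
  proof (intro ballI)
    fix i j assume ij: "i \<in> I" "j \<in> I"
    have ne: "p ! i \<noteq> p ! j" "q ! i \<noteq> q ! j" if "i \<noteq> j"
      using that ij I p q by (auto simp: nth_eq_iff_index_eq subset_iff)
    consider "i < j" | "i = j" | "j < i" by linarith
    then show "p ! i < p ! j \<longleftrightarrow> q ! i < q ! j"
    proof cases
      case 3
      with *[OF ij(2,1)] ne show ?thesis by (metis not_less_iff_gr_or_eq)
    qed (use * ij in auto)
  qed
  show "p ! i = q ! i"
  proof (cases "i \<in> B")
    case True
    show ?thesis
    proof (rule order_embedding_unique[where f = "(!) p" and g = "(!) q" and I = B])
      show "p ! i < p ! j \<longleftrightarrow> q ! i < q ! j" if "i \<in> B" "j \<in> B" for i j
        using lessI[OF sub] blue_order[OF p] blue_order[OF q] R that by auto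
    qed (use sub inj assms(8) True finite_subset in \<open>auto intro: inj_on_subset\<close>)
  next
    case False
    let ?I = "{..<n} - B"
    have "(!) p ` {..<n} = set p" "(!) q ` {..<n} = set q"
      using p q by (auto simp: set_conv_nth)
    then have "(!) p ` ?I = (!) q ` ?I"
      using inj sub assms(7,8) by (simp add: inj_on_image_set_diff[of _ "{..<n}"])
    moreover have "\<forall>i\<in>?I. \<forall>j\<in>?I. p ! i < p ! j \<longleftrightarrow> q ! i < q ! j"
      by (rule lessI) (use red_order[OF p] red_order[OF q] L in auto)
    ultimately show ?thesis
      using False i inj by (intro order_embedding_unique[where f = "(!) p" and g = "(!) q" and I = ?I]) (auto intro: inj_on_subset)
  qed
qed (use p q in simp)

lemma length_perm: "p \<in> perms_of_length n \<Longrightarrow> distinct p \<and> length p = n"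
  by (auto simp: perms_of_length_def simp flip: distinct_card)

lemma finite_perms: "finite (perms_of_length n)"
proof (rule finite_subset)
  show "perms_of_length n \<subseteq> {p. set p \<subseteq> {1..n} \<and> length p = n}"
    using length_perm by (auto simp: perms_of_length_def)
qed (simp add: finite_lists_length_eq)

lemma S_1324_le_walks: "S_1324 n \<le> 2 ^ n * (\<Sum>m\<le>n. card (walks n [m]))"
proof -
  let ?A = "{p \<in> perms_of_length n. avoids_1324 p}"
  define B where "B p = blues p n" for p
  define F where "F p = ((!) p ` B p, diagram.history (B p) (first_below p (B p)) (last_above p (B p)) n)" for p
  have props: "distinct p" "length p = n" "merge_colouring n p (B p)" "set p = {1..n}"
      "diagram n (B p) (first_below p (B p)) (last_above p (B p))" if "p \<in> ?A" for p
    using that length_perm[of p n] merge_colouring_blues[of p n] diagram_of_perm[of p n "B p"]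
    by (auto simp: B_def perms_of_length_def)
  have "inj_on F ?A"
  proof (rule inj_onI)
    fix p q assume pq: "p \<in> ?A" "q \<in> ?A" "F p = F q"
    note P = props[OF pq(1)] and Q = props[OF pq(2)]
    have eq: "B p = B q" "\<forall>i<n. i \<notin> B p \<longrightarrow> first_below p (B p) i = first_below q (B q) i"
        "\<forall>i\<in>B p. last_above p (B p) i = last_above q (B q) i"
      using diagram_eqI[OF P(5) Q(5)] pq(3) by (auto simp: F_def)
    show "p = q"
      by (rule perm_eqI[OF P(1-3) Q(1,2)]) (use P Q eq pq(3) in \<open>auto simp: F_def\<close>)
  qed
  moreover have "F ` ?A \<subseteq> Pow {1..n} \<times> (\<Union>m\<le>n. walks n [m])"
  proof
    fix x assume "x \<in> F ` ?A"
    then obtain p where p: "p \<in> ?A" "x = F p" by auto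
    note P = props[OF p(1)]
    have "(!) p ` B p \<subseteq> set p" using P(2,3) by (auto simp: merge_colouring_def)
    then show "x \<in> Pow {1..n} \<times> (\<Union>m\<le>n. walks n [m])"
      using diagram.history_mem[OF P(5)] P(4) p(2) by (auto simp: F_def)
  qed
  ultimately have "card ?A \<le> card (Pow {1..n} \<times> (\<Union>m\<le>n. walks n [m]))"
    using finite_walks by (intro card_inj_on_le) auto
  also have "\<dots> \<le> 2 ^ n * (\<Sum>m\<le>n. card (walks n [m]))"
    using card_UN_le[of "{..n}" "\<lambda>m. walks n [m]"] by (simp add: card_cartesian_product card_Pow)
  finally show ?thesis by (simp add: S_1324_def)
qed

section \<open>The growth rate\<close>

lemma S_1324_le: "real (S_1324 n) \<le> 13/5 * (55/4) ^ n"
proof -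
  \<comment> \<open>The order \<open>n + 3\<close> is at least \<open>n\<close>, as
    \<open>walk_weight_le\<close> requires, and at least 3, as \<open>poly_run_poly_le\<close>
    requires.\<close>
  let ?p = "run_poly (n + 3) n"
  \<comment> \<open>\<open>4/55\<close> is half of \<open>8/55\<close>; the half absorbs the factor
    \<open>2 ^ n\<close>.\<close>
  have "(4/55) ^ n * real (S_1324 n) \<le> (4/55) ^ n * real (2 ^ n * (\<Sum>m\<le>n. card (walks n [m])))"
    using S_1324_le_walks[of n] by (intro mult_left_mono) (simp_all only: of_nat_le_iff, simp)
  also have "\<dots> = (\<Sum>m\<le>n. walk_weight n [m])"
    by (simp add: walk_weight_def sum_distrib_left flip: power_mult_distrib mult.assoc)
  also have "\<dots> \<le> sum (coeff ?p) {..n}"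
  proof (rule sum_mono)
    show "walk_weight n [m] \<le> coeff ?p m" for m
      using walk_weight_le[of n "n + 3" "[m]"] by (simp add: run_bound_def)
  qed
  also have "\<dots> \<le> poly ?p 1"
    by (rule sum_coeff_le_poly_1[OF run_poly_nonneg]) simp
  also have "\<dots> \<le> 13/5"
    by (rule poly_run_poly_le) simp
  finally have "(55/4) ^ n * ((4/55) ^ n * real (S_1324 n)) \<le> (55/4) ^ n * (13/5)"
    by (rule mult_left_mono) simp
  then show ?thesis
    by (simp flip: power_mult_distrib mult.assoc)
qed

section \<open>Supermultiplicativity by skew sums\<close>

lemma avoids_1324_skew_append:
  assumes "avoids_1324 p" "avoids_1324 q" and gt: "\<And>x y. x \<in> set p \<Longrightarrow> y \<in> set q \<Longrightarrow> y < x"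
  shows "avoids_1324 (p @ q)"
  unfolding avoids_1324_def
proof
  assume "\<exists>i1 i2 i3 i4. i1 < i2 \<and> i2 < i3 \<and> i3 < i4 \<and> i4 < length (p @ q) \<and>
      (p @ q) ! i1 < (p @ q) ! i3 \<and> (p @ q) ! i3 < (p @ q) ! i2 \<and> (p @ q) ! i2 < (p @ q) ! i4"
  then obtain a b c d where abcd: "a < b" "b < c" "c < d" "d < length (p @ q)"
    and pat: "(p @ q) ! a < (p @ q) ! c" "(p @ q) ! c < (p @ q) ! b" "(p @ q) ! b < (p @ q) ! d"
    by (elim exE conjE)
  let ?l = "length p"
  consider "d < ?l" | "?l \<le> a" | "a < ?l" "?l \<le> d" by linarith
  then show False
  proof cases
    case 1
    with avoids_1324D[OF assms(1), of a b c d] abcd pat show False by (simp add: nth_append)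
  next
    case 2
    with abcd have "d - ?l < length q" by simp
    with 2 avoids_1324D[OF assms(2), of "a - ?l" "b - ?l" "c - ?l" "d - ?l"] abcd pat show False
      by (simp add: nth_append diff_less_mono)
  next
    \<comment> \<open>The first entry of a 1324 is smaller than its last, but every entry of
      \<open>q\<close> is below every entry of \<open>p\<close>, so no occurrence straddles the two
      blocks.\<close>
    case 3
    with abcd(4) have "(p @ q) ! d < (p @ q) ! a"
      using gt[of "p ! a" "q ! (d - ?l)"] by (simp add: nth_append)
    with pat show False by simp
  qed
qed

lemma avoids_1324_map_add: "avoids_1324 (map (\<lambda>x. x + n) p) \<longleftrightarrow> avoids_1324 p"
proof -
  have "map (\<lambda>x. x + n) p ! i < map (\<lambda>x. x + n) p ! j \<longleftrightarrow> p ! i < p ! j"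
    if "i < length p" "j < length p" for i j
    using that by simp
  then show ?thesis
    unfolding avoids_1324_def length_map by (meson less_trans)
qed

lemma S_1324_add: "S_1324 m * S_1324 n \<le> S_1324 (m + n)"
proof -
  let ?A = "\<lambda>n. {p \<in> perms_of_length n. avoids_1324 p}"
  let ?f = "\<lambda>(p, q). map (\<lambda>x. x + n) p @ q"
  have "?f ` (?A m \<times> ?A n) \<subseteq> ?A (m + n)"
  proof clarsimp
    fix p q assume pq: "p \<in> perms_of_length m" "avoids_1324 p" "q \<in> perms_of_length n" "avoids_1324 q"
    have "(\<lambda>x. x + n) ` {1..m} \<union> {1..n} = {1..m + n}"
      using image_add_atLeastAtMost[of n 1 m] by (auto simp: add.commute)
    with pq show "map (\<lambda>x. x + n) p @ q \<in> perms_of_length (m + n) \<and> avoids_1324 (map (\<lambda>x. x + n) p @ q)"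
      by (auto simp: perms_of_length_def distinct_map inj_on_def avoids_1324_map_add
          intro!: avoids_1324_skew_append)
  qed
  moreover have "inj_on ?f (?A m \<times> ?A n)"
    using length_perm by (auto simp: inj_on_def dest!: map_inj_on intro: injI)
  ultimately have "card (?A m \<times> ?A n) \<le> card (?A (m + n))"
    using finite_perms by (intro card_inj_on_le) auto
  then show ?thesis by (simp add: S_1324_def card_cartesian_product)
qed

lemma S_1324_pos: "0 < S_1324 n"
proof (induction n)
  case 0
  have "[] \<in> {p \<in> perms_of_length 0. avoids_1324 p}"
    by (simp add: perms_of_length_def avoids_1324_def)
  then show ?case
    using finite_perms by (auto simp: S_1324_def card_gt_0_iff)
next
  case (Suc n)
  have "[1] \<in> {p \<in> perms_of_length 1. avoids_1324 p}"
    by (auto simp: perms_of_length_def avoids_1324_def)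
  then have "0 < S_1324 1"
    using finite_perms by (auto simp: S_1324_def card_gt_0_iff)
  with Suc have "0 < S_1324 n * S_1324 1" by simp
  also note S_1324_add[of n 1]
  finally show ?case by simp
qed

text \<open>Fekete's argument with the supremum as limit: \<open>n div m\<close> is at least
  \<open>n / m - 1\<close>, so \<open>a n / n\<close> is at least \<open>a m / m\<close> up to the
  error \<open>a m / n\<close>, which vanishes for fixed \<open>m\<close>.\<close>

lemma superadditive_limit:
  fixes a :: "nat \<Rightarrow> real"
  assumes add: "\<And>m n. a m + a n \<le> a (m + n)" and nonneg: "\<And>n. 0 \<le> a n"
    and bound: "\<And>n. 1 \<le> n \<Longrightarrow> a n \<le> C * real n"
  shows "convergent (\<lambda>n. a n / real n)"
proof -
  define l where "l = (SUP n\<in>{1..}. a n / real n)"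
  have bdd: "bdd_above ((\<lambda>n. a n / real n) ` {1..})"
    using bound by (intro bdd_aboveI2[of _ _ C]) (auto simp: field_simps)
  have le: "a n / real n \<le> l" if "1 \<le> n" for n
    unfolding l_def using that bdd by (intro cSUP_upper) auto
  have mult: "real q * a m \<le> a (q * m)" for q m
  proof (induction q)
    case (Suc q)
    with add[of m "q * m"] show ?case by (simp add: algebra_simps)
  qed (simp add: nonneg)
  have "(\<lambda>n. a n / real n) \<longlonglongrightarrow> l"
  proof (rule order_tendstoI)
    fix y assume "y < l"
    then obtain m where m: "1 \<le> m" "y < a m / real m"
      unfolding l_def using less_cSUP_iff[OF _ bdd] by auto
    have "(\<lambda>n. a m / real m - a m / real n) \<longlonglongrightarrow> a m / real m - 0"
      by (intro tendsto_intros lim_const_over_n)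
    then have "\<forall>\<^sub>F n in sequentially. y < a m / real m - a m / real n"
      using m(2) by (auto dest: order_tendstoD)
    then show "\<forall>\<^sub>F n in sequentially. y < a n / real n"
      using eventually_gt_at_top[of 0]
    proof eventually_elim
      case (elim n)
      have "real n \<le> real (n div m * m) + real m"
        using mod_less_divisor[of m n] m(1) div_mult_mod_eq[of n m] by linarith
      then have "real n / real m - 1 \<le> real (n div m)"
        using m(1) by (simp add: field_simps)
      then have "(real n / real m - 1) * a m \<le> real (n div m) * a m"
        by (rule mult_right_mono[OF _ nonneg])
      also have "\<dots> \<le> a (n div m * m)" by (rule mult)
      also have "\<dots> \<le> a n"
        using add[of "n div m * m" "n mod m"] nonneg[of "n mod m"] by simp
      finally have "(real n / real m - 1) * a m / real n \<le> a n / real n"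
        by (rule divide_right_mono) simp
      then have "a m / real m - a m / real n \<le> a n / real n"
        using elim(2) m(1) by (simp add: left_diff_distrib diff_divide_distrib)
      with elim(1) show ?case by simp
    qed
  next
    fix y assume "l < y"
    then show "\<forall>\<^sub>F n in sequentially. a n / real n < y"
      by (intro eventually_sequentiallyI[of 1] le_less_trans[OF le])
  qed
  then show ?thesis by (rule convergentI)
qed

theorem theorem3p5:
  shows "convergent (\<lambda>n. root n (real (S_1324 n))) \<and>
         lim (\<lambda>n. root n (real (S_1324 n))) \<le> 13.7595074"
proof -
  let ?a = "\<lambda>n. ln (real (S_1324 n))"
  have pos: "1 \<le> real (S_1324 n)" for n
    using S_1324_pos[of n] by simp
  have "convergent (\<lambda>n. ?a n / real n)"
  proof (rule superadditive_limit)
    show "?a m + ?a n \<le> ?a (m + n)" for m n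
    proof -
      have "?a m + ?a n = ln (real (S_1324 m * S_1324 n))"
        using S_1324_pos by (simp add: ln_mult)
      also have "\<dots> \<le> ?a (m + n)"
        using S_1324_pos S_1324_add[of m n] by (subst ln_le_cancel_iff) (simp_all flip: of_nat_mult)
      finally show ?thesis .
    qed
    show "0 \<le> ?a n" for n using pos by simp
    show "?a n \<le> ln (13/5 * (55/4)) * real n" if "1 \<le> n" for n
    proof -
      have "real (S_1324 n) \<le> 13/5 * (55/4) ^ n" by (rule S_1324_le)
      also have "\<dots> \<le> (13/5) ^ n * (55/4) ^ n"
        using that self_le_power[of "13/5 :: real" n] by simp
      also have "\<dots> = (13/5 * (55/4)) ^ n" by (simp only: power_mult_distrib)
      finally have "?a n \<le> ln ((13/5 * (55/4)) ^ n)"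
        using S_1324_pos[of n] by (subst ln_le_cancel_iff) auto
      then show ?thesis by (simp add: ln_realpow mult.commute)
    qed
  qed
  then obtain l where "(\<lambda>n. ?a n / real n) \<longlonglongrightarrow> l" by (auto simp: convergent_def)
  then have "(\<lambda>n. exp (?a n / real n)) \<longlonglongrightarrow> exp l" by (rule tendsto_exp)
  moreover have "\<forall>\<^sub>F n in sequentially. exp (?a n / real n) = root n (real (S_1324 n))"
    using eventually_gt_at_top[of 0]
  proof eventually_elim
    case (elim n)
    then show ?case
      using S_1324_pos[of n] by (simp add: root_powr_inverse powr_def)
  qed
  ultimately have lim: "(\<lambda>n. root n (real (S_1324 n))) \<longlonglongrightarrow> exp l"
    by (rule Lim_transform_eventually)
  \<comment> \<open>The constant \<open>13/5\<close> disappears under the \<open>n\<close>-th root,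
    leaving \<open>55/4 = 13.75\<close>, which is below the claimed bound.\<close>
  have "(\<lambda>n. root n (13/5) * (55/4)) \<longlonglongrightarrow> 1 * (55/4)"
    by (intro tendsto_intros LIMSEQ_root_const) simp
  moreover have "root n (real (S_1324 n)) \<le> root n (13/5) * (55/4)" if "1 \<le> n" for n
  proof -
    have "root n (real (S_1324 n)) \<le> root n (13/5 * (55/4) ^ n)"
      by (rule real_root_le_mono[OF _ S_1324_le]) (use that in simp)
    also have "\<dots> = root n (13/5) * root n ((55/4) ^ n)" by (rule real_root_mult)
    also have "root n ((55/4) ^ n) = 55/4"
      using that by (intro real_root_power_cancel) auto
    finally show ?thesis .
  qed
  ultimately have "exp l \<le> 1 * (55/4)"
    using LIMSEQ_le[OF lim] by blast
  with lim show ?thesis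
    by (auto simp: limI intro: convergentI)
qed

end
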